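(* The following hold for the Cantor fan $C$. 1. There is a continuous mapping $f:C\to C$ that is not a homeomorphism such that $(C,f)$ is chaotic in the sense of Devaney. 2. There is a homeomorphism $h:C\to C$ such that $(C,h)$ is chaotic in the sense of Devaney.
   Context: A Cantor fan is any continuum (non-empty compact connected metric space) homeomorphic to $\bigcup_{c\in K}A_c$, where $K\subseteq[0,1]$ is a Cantor set and, for each $c\in K$, $A_c$ is the convex segment in the plane from $(0,0)$ to $(c,-1)$; it is unique up to homeomorphism. A dynamical system is a pair $(X,f)$ where $X$ is a compact metric space and $f:X\to X$ is continuous. $(X,f)$ is transitive if for all non-empty open $U,V\subseteq X$ there is a non-negative integer $n$ with $f^n(U)\cap V\ne\emptyset$. $\mathcal P(f)$ denotes the set of periodic points, i.e. points $p$ with $f^n(p)=p$ for some positive integer $n$. $(X,f)$ is chaotic in the sense of Devaney if it is transitive and $\mathcal P(f)$ is dense in $X$. *)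

theory Defs
  imports "HOL-Analysis.Analysis"
begin

text \<open>All the notions involved are topological, so a compact metric space is represented by a
  compact metrizable topology on an arbitrary carrier type.\<close>

definition continuum :: "'a topology \<Rightarrow> bool" where
  "continuum X \<longleftrightarrow>
     topspace X \<noteq> {} \<and> compact_space X \<and> connected_space X \<and> metrizable_space X"

definition ternary_cantor_set :: "real set" where
  "ternary_cantor_set =
     {(\<Sum>n. a n / 3 ^ Suc n) | a :: nat \<Rightarrow> real. \<forall>n. a n \<in> {0, 2}}"

definition cantor_set :: "real set \<Rightarrow> bool" where
  "cantor_set K \<longleftrightarrow> K homeomorphic ternary_cantor_set"

definition planar_fan :: "real set \<Rightarrow> (real \<times> real) set" where
  "planar_fan K = (\<Union>c\<in>K. closed_segment (0, 0) (c, - 1))"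

definition cantor_fan :: "'a topology \<Rightarrow> bool" where
  "cantor_fan X \<longleftrightarrow> continuum X \<and>
     (\<exists>K. K \<subseteq> {0..1} \<and> cantor_set K \<and> X homeomorphic_space top_of_set (planar_fan K))"

definition dynamical_system :: "'a topology \<Rightarrow> ('a \<Rightarrow> 'a) \<Rightarrow> bool" where
  "dynamical_system X f \<longleftrightarrow> compact_space X \<and> metrizable_space X \<and> continuous_map X X f"

definition transitive_system :: "'a topology \<Rightarrow> ('a \<Rightarrow> 'a) \<Rightarrow> bool" where
  "transitive_system X f \<longleftrightarrow>
     (\<forall>U V. openin X U \<and> U \<noteq> {} \<and> openin X V \<and> V \<noteq> {} \<longrightarrow>
        (\<exists>n. (f ^^ n) ` U \<inter> V \<noteq> {}))"

definition periodic_points :: "'a topology \<Rightarrow> ('a \<Rightarrow> 'a) \<Rightarrow> 'a set" where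
  "periodic_points X f = {p \<in> topspace X. \<exists>n>0. (f ^^ n) p = p}"

definition devaney_chaotic :: "'a topology \<Rightarrow> ('a \<Rightarrow> 'a) \<Rightarrow> bool" where
  "devaney_chaotic X f \<longleftrightarrow> dynamical_system X f \<and> transitive_system X f \<and>
     X closure_of periodic_points X f = topspace X"

end

theory Submission
  imports Defs
begin

text \<open>The Cantor fan is the cone over a Cantor set: a homeomorphism of a Cantor set with a sequence
  space turns it into the quotient of (sequences) \<open>\<times> [0,1]\<close> in which the slice \<open>t = 0\<close> is collapsed to
  the apex. A continuous self-map of the product that preserves this slice descends to the fan, so
  it suffices to find a chaotic skew product over a shift whose fibre maps fix \<open>0\<close>.

  The fibre over a sequence \<open>x\<close> moves by \<open>t \<mapsto> t powr exp (weight (x 0))\<close>. These maps form a flow: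
  composing them adds the weights, so after \<open>n\<close> steps only the sum of the first \<open>n\<close> weights matters,
  and the flow is simply transitive on \<open>{0<..<1}\<close>. There are four symbols, with weights \<open>\<plusminus>1\<close> and
  \<open>\<plusminus>sqrt 2\<close>, and this choice gives both halves of chaos.
  \<^item> Weights come in opposite pairs. Any finite word can therefore be followed by its negative, and
    repeating the resulting word of total weight \<open>0\<close> gives a periodic sequence whose entire fibre
    consists of periodic points (\<open>skew_periodic_dense\<close>).
  \<^item> Sums of weights are dense in the reals (\<open>weights_dense\<close>), because \<open>sqrt 2\<close> is irrational. Between
    two prescribed words one can therefore insert a third that carries a given height close to any
    other given height (\<open>skew_transitive\<close>).

  Both properties pass to factors (\<open>devaney_chaotic_factor\<close>). The two-sided shift is invertible and
  induces a homeomorphism of the fan. The one-sided shift is a factor of the two-sided one, by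
  forgetting the past; the map that it induces on the fan is hence chaotic too. It is not injective:
  the shift drops the symbol at \<open>0\<close>, and at the fixed height \<open>1\<close> the fibre coordinate does not record
  it either.\<close>

section \<open>The symbolic skew product\<close>

type_synonym symbol = "bool \<times> bool"

definition weight :: "symbol \<Rightarrow> real" where
  "weight a = (if fst a then 1 else - 1) * (if snd a then 1 else sqrt 2)"

definition opposite :: "symbol \<Rightarrow> symbol" where
  "opposite a = (\<not> fst a, snd a)"

lemma weight_opposite [simp]: "weight (opposite a) = - weight a"
  by (simp add: weight_def opposite_def)

lemma opposite_opposite [simp]: "opposite (opposite a) = a"
  by (simp add: opposite_def)

text \<open>The index type is a semiring so that the same definition gives the skew product over the
  one-sided shift (\<open>nat\<close>) and over the two-sided shift (\<open>int\<close>).\<close>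

definition skew :: "('i::comm_semiring_1 \<Rightarrow> symbol) \<times> real \<Rightarrow> ('i \<Rightarrow> symbol) \<times> real" where
  "skew p = (\<lambda>i. fst p (i + 1), snd p powr exp (weight (fst p 0)))"

abbreviation cylinder :: "(('i \<Rightarrow> symbol) \<times> real) topology" where
  "cylinder \<equiv> top_of_set (UNIV \<times> {0..1})"

lemma skew_iterate:
  fixes x :: "'i::comm_semiring_1 \<Rightarrow> symbol"
  assumes "0 \<le> t"
  shows "(skew ^^ n) (x, t)
    = (\<lambda>i. x (i + of_nat n), t powr exp (\<Sum>k<n. weight (x (of_nat k))))"
proof (induction n)
  case 0
  then show ?case using assms by simp
next
  case (Suc n)
  then show ?case
    by (simp add: skew_def powr_powr exp_add[symmetric] add_ac)
qed

lemma skew_in_cylinder: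
  assumes "p \<in> topspace cylinder"
  shows "skew p \<in> topspace cylinder"
  using assms by (auto simp: skew_def powr_le1)

lemma continuous_map_skew: "continuous_map cylinder cylinder skew"
proof -
  have weight: "continuous_on A weight" for A
    by (rule continuous_on_subset[OF continuous_on_finite[of UNIV]]) simp_all
  have coord: "continuous_on A (\<lambda>p::('a \<Rightarrow> symbol) \<times> real. fst p i)" for A i
    by (rule continuous_on_product_then_coordinatewise) (intro continuous_intros)
  have "continuous_on (UNIV \<times> {0..1})
      (\<lambda>p::('a \<Rightarrow> symbol) \<times> real. snd p powr exp (weight (fst p 0)))"
    by (intro continuous_on_powr' continuous_intros continuous_on_compose2[OF weight coord]) auto
  then have "continuous_on (UNIV \<times> {0..1}) (skew :: ('a \<Rightarrow> symbol) \<times> real \<Rightarrow> _)"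
    unfolding skew_def by (intro continuous_on_Pair continuous_on_coordinatewise_then_product coord)
  moreover have "skew \<in> UNIV \<times> {0..1} \<rightarrow> UNIV \<times> {0..1}"
    using skew_in_cylinder by auto
  ultimately show ?thesis
    by (simp add: image_subset_iff_funcset)
qed

text \<open>Over the two-sided shift both coordinates can be undone: the shift by moving back, the fibre
  map by the exponent with the opposite weight.\<close>

lemma skew_inj:
  "inj_on (skew :: (int \<Rightarrow> symbol) \<times> real \<Rightarrow> _) (topspace cylinder)"
proof (rule inj_onI, clarsimp)
  fix x y :: "int \<Rightarrow> symbol" and t s :: real
  assume t: "0 \<le> t" and s: "0 \<le> s" and eq: "skew (x, t) = skew (y, s)"
  have "x = y"
  proof
    fix i
    show "x i = y i"
      using fun_cong[of "\<lambda>i. x (i + 1)" "\<lambda>i. y (i + 1)" "i - 1"] eq by (simp add: skew_def)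
  qed
  moreover have "(t powr exp c) powr exp (- c) = t" if "t \<ge> 0" for t c :: real
    using that by (simp add: powr_powr exp_minus)
  ultimately show "x = y \<and> t = s"
    using eq t s by (metis skew_def fst_conv snd_conv)
qed

lemma skew_surj:
  "skew ` topspace cylinder = (topspace cylinder :: ((int \<Rightarrow> symbol) \<times> real) set)"
proof (intro equalityI subsetI)
  fix p :: "(int \<Rightarrow> symbol) \<times> real"
  assume p: "p \<in> topspace cylinder"
  define p' where "p' = (\<lambda>i. fst p (i - 1), snd p powr exp (- weight (fst p (- 1))))"
  have "skew p' = p"
    using p by (auto simp: skew_def p'_def powr_powr exp_minus)
  moreover have "p' \<in> topspace cylinder"
    using p by (auto simp: p'_def powr_le1)
  ultimately show "p \<in> skew ` topspace cylinder" by blast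
qed (use skew_in_cylinder in blast)

section \<open>Dense periodic points and transitivity\<close>

definition box :: "nat \<Rightarrow> real \<Rightarrow> (int \<Rightarrow> symbol) \<times> real \<Rightarrow> ((int \<Rightarrow> symbol) \<times> real) set" where
  "box m e p = {q. (\<forall>i. \<bar>i\<bar> \<le> int m \<longrightarrow> fst q i = fst p i) \<and> \<bar>snd q - snd p\<bar> < e}"

text \<open>A basic open set of the product topology constrains finitely many coordinates only; an
  interval of indices around \<open>0\<close> contains all of them.\<close>

lemma open_contains_box:
  fixes U :: "((int \<Rightarrow> symbol) \<times> real) set"
  assumes "open U" "(x, t) \<in> U"
  obtains e m where "0 < e" "box m e (x, t) \<subseteq> U"
proof -
  obtain A B where AB: "open A" "open B" "(x, t) \<in> A \<times> B" "A \<times> B \<subseteq> U"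
    using open_prod_elim[OF assms] .
  obtain e where e: "e > 0" "ball t e \<subseteq> B"
    using openE[OF AB(2)] AB(3) by (metis mem_Times_iff snd_conv)
  have "openin (product_topology (\<lambda>i::int. euclidean :: symbol topology) UNIV) A"
    using AB(1) by (simp add: euclidean_product_topology)
  then have "\<forall>x\<in>A. \<exists>W. finite {i. W i \<noteq> UNIV} \<and> x \<in> Pi\<^sub>E UNIV W \<and> Pi\<^sub>E UNIV W \<subseteq> A"
    unfolding openin_product_topology_alt by simp meson
  moreover have "x \<in> A" using AB(3) by simp
  ultimately obtain W where W: "finite {i. W i \<noteq> UNIV}" "x \<in> Pi\<^sub>E UNIV W" "Pi\<^sub>E UNIV W \<subseteq> A"
    by blast
  obtain m where m: "\<And>i. W i \<noteq> UNIV \<Longrightarrow> nat \<bar>i\<bar> \<le> m"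
    using finite_nat_set_iff_bounded_le[of "(\<lambda>i. nat \<bar>i\<bar>) ` {i. W i \<noteq> UNIV}"] W(1) by auto
  show thesis
  proof (rule that[of e m], safe)
    fix y s assume "(y, s) \<in> box m e (x, t)"
    then have y: "\<And>i. \<bar>i\<bar> \<le> int m \<Longrightarrow> y i = x i" and s: "\<bar>s - t\<bar> < e"
      by (simp_all add: box_def)
    have "y i \<in> W i" for i
    proof (cases "W i = UNIV")
      case False
      then have "\<bar>i\<bar> \<le> int m" using m by fastforce
      then show ?thesis using y W(2) by (auto simp: PiE_iff)
    qed auto
    then have "y \<in> A" using W(3) by auto
    moreover have "s \<in> B" using e(2) s by (auto simp: dist_real_def abs_minus_commute)
    ultimately show "(y, s) \<in> U" using AB(4) by auto
  qed (fact e)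
qed

text \<open>The fibre endpoints \<open>0\<close> and \<open>1\<close> are fixed by every fibre map, so no orbit leaves them. Boxes
  around interior heights avoid this, and they suffice since the interior of the fibre is dense.\<close>

lemma open_in_cylinder_contains_interior_box:
  assumes "openin (cylinder :: ((int \<Rightarrow> symbol) \<times> real) topology) U" "U \<noteq> {}"
  obtains e t m x where "0 < e" "0 < t" "t < 1" "box m e (x, t) \<inter> topspace cylinder \<subseteq> U"
proof -
  obtain T where T: "open T" "U = (UNIV \<times> {0..1}) \<inter> T"
    using assms(1) by (auto simp: openin_open)
  obtain p where p: "p \<in> U" using assms(2) by blast
  obtain x t where "p = (x, t)" by fastforce
  then have xt: "(x, t) \<in> T" "0 \<le> t" "t \<le> 1"
    using p T(2) by simp_all
  obtain e m where me: "0 < e" "box m e (x, t) \<subseteq> T"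
    using open_contains_box[OF T(1) xt(1)] .
  have "max (t - e) 0 < min (t + e) 1"
    using me(1) xt by auto
  then obtain s where s: "max (t - e) 0 < s" "s < min (t + e) 1"
    using dense by blast
  show thesis
  proof (rule that[of "e - \<bar>s - t\<bar>" s m x])
    have "box m (e - \<bar>s - t\<bar>) (x, s) \<subseteq> box m e (x, t)"
      by (auto simp: box_def)
    then show "box m (e - \<bar>s - t\<bar>) (x, s) \<inter> topspace cylinder \<subseteq> U"
      using me(2) T(2) by auto
  qed (use s in auto)
qed

lemma sum_lessThan_split:
  fixes f :: "nat \<Rightarrow> real"
  shows "(\<Sum>k<a + b. f k) = (\<Sum>k<a. f k) + (\<Sum>k<b. f (a + k))"
  by (induction b) auto

text \<open>The word that \<open>x\<close> shows on the window \<open>{-m..m}\<close>, of length \<open>L = 2 * m + 1\<close>, is continued to a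
  sequence \<open>y\<close> with \<open>y (i + L) = opposite (y i)\<close>. Its period is \<open>2 * L\<close> and the weights cancel over one
  period, so that every point of the fibre over \<open>y\<close> returns.\<close>

lemma skew_periodic_dense:
  "cylinder closure_of periodic_points cylinder (skew :: (int \<Rightarrow> symbol) \<times> real \<Rightarrow> _)
    = topspace cylinder"
proof (subst dense_intersects_open, intro allI impI, elim conjE)
  fix U :: "((int \<Rightarrow> symbol) \<times> real) set"
  assume W: "openin cylinder U" "U \<noteq> {}"
  obtain e t m x where U: "0 < e" "0 < t" "t < 1" "box m e (x, t) \<inter> topspace cylinder \<subseteq> U"
    using open_in_cylinder_contains_interior_box[OF W] .
  define L where "L = 2 * m + 1"
  define y where "y i = (let a = x ((i + int m) mod int L - int m)
    in if even ((i + int m) div int L) then a else opposite a)" for i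
  have L: "int L \<noteq> 0" by (simp add: L_def)
  have anti: "y (i + int L) = opposite (y i)" for i
  proof -
    have "i + int L + int m = (i + int m) + int L" by simp
    then show ?thesis
      unfolding y_def Let_def using L by (simp only: div_add_self2 mod_add_self2) simp
  qed
  have agree: "y i = x i" if "\<bar>i\<bar> \<le> int m" for i
  proof -
    have "(i + int m) div int L = 0" "(i + int m) mod int L = i + int m"
      using that by (auto simp: L_def div_pos_pos_trivial mod_pos_pos_trivial)
    then show ?thesis by (simp add: y_def)
  qed
  have "(\<Sum>k<L + L. weight (y (int k)))
      = (\<Sum>k<L. weight (y (int k))) + (\<Sum>k<L. weight (y (int (L + k))))"
    by (rule sum_lessThan_split)
  also have "\<dots> = 0"
    using anti by (simp add: add.commute sum.distrib[symmetric])
  finally have zero: "(\<Sum>k<L + L. weight (y (int k))) = 0" .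
  have "y (i + int (L + L)) = y i" for i
    using anti[of "i + int L"] anti[of i] by (simp add: add.assoc)
  then have "(skew ^^ (L + L)) (y, t) = (y, t)"
    using U zero by (simp add: skew_iterate)
  moreover have "L + L > 0" by (simp add: L_def)
  ultimately have "(y, t) \<in> periodic_points cylinder skew"
    using U unfolding periodic_points_def by auto
  moreover have "(y, t) \<in> U"
    using U agree by (auto simp: box_def)
  ultimately show "periodic_points cylinder skew \<inter> U \<noteq> {}" by auto
qed

text \<open>The sums of weights form the ring \<open>\<int>[sqrt 2]\<close>: a group that is closed under multiplication by
  \<open>sqrt 2\<close>. It contains the powers of \<open>sqrt 2 - 1\<close>, which are arbitrarily small positive numbers, and
  the integer multiples of a positive number below \<open>e\<close> come within \<open>e\<close> of every real.\<close>

lemma weights_dense: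
  assumes "0 < e"
  obtains w where "\<bar>sum_list (map weight w) - c\<bar> < e"
proof -
  define G where "G = range (\<lambda>w. sum_list (map weight w))"
  have add: "a + b \<in> G" if "a \<in> G" "b \<in> G" for a b
    using that unfolding G_def by (metis (no_types, lifting) imageE map_append rangeI sum_list_append)
  have neg: "- a \<in> G" if "a \<in> G" for a
  proof -
    have "sum_list (map weight (map opposite w)) = - sum_list (map weight w)" for w
      by (induction w) auto
    then show ?thesis using that unfolding G_def by (metis (no_types, lifting) imageE rangeI)
  qed
  have gen: "weight a \<in> G" for a
    unfolding G_def by (rule range_eqI[of _ _ "[a]"]) simp
  have one: "1 \<in> G" using gen[of "(True, True)"] by (simp add: weight_def)
  have times_sqrt2: "sqrt 2 * a \<in> G" if "a \<in> G" for a
  proof -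
    have "sqrt 2 * sum_list (map weight w) \<in> G" for w
    proof (induction w)
      case Nil
      then show ?case unfolding G_def by (auto intro: range_eqI[of _ _ "[]"])
    next
      case (Cons a w)
      \<comment> \<open>Multiplication by \<open>sqrt 2\<close> sends the weight \<open>1\<close> to \<open>sqrt 2\<close>, and \<open>sqrt 2\<close> to \<open>2 = 1 + 1\<close>.\<close>
      have "sqrt 2 * weight a \<in> G"
        using gen[of "(fst a, False)"] add[OF one one] neg[OF add[OF one one]]
        by (auto simp: weight_def)
      then show ?case using Cons add by (simp add: distrib_left)
    qed
    then show ?thesis using that unfolding G_def by blast
  qed
  define d where "d = sqrt 2 - 1"
  have d: "0 < d" "d < 1"
    using real_less_rsqrt[of 1 2] real_less_lsqrt[of 2 2] by (auto simp: d_def)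
  have pow: "d ^ k \<in> G" for k
  proof (induction k)
    case (Suc k)
    then show ?case
      using add[OF times_sqrt2 neg] by (simp add: d_def left_diff_distrib)
  qed (use one in simp)
  obtain k where k: "d ^ k < e"
    using real_arch_pow_inv[OF assms d(2)] by blast
  define g where "g = d ^ k"
  have g: "g > 0" "g \<in> G" "g < e" using d pow k by (auto simp: g_def)
  have nat_mult: "of_nat n * g \<in> G" for n
    by (induction n) (use add[OF g(2)] add[OF g(2) neg[OF g(2)]] in \<open>auto simp: distrib_right\<close>)
  have int_mult: "of_int n * g \<in> G" for n
    using nat_mult neg by (cases n rule: int_cases2) fastforce+
  define n where "n = \<lfloor>c / g\<rfloor>"
  have "of_int n * g \<le> c" "c < (of_int n + 1) * g"
    using g by (simp_all add: n_def pos_le_divide_eq[symmetric] pos_divide_less_eq[symmetric])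
  then have "\<bar>of_int n * g - c\<bar> < e"
    using g by (simp add: distrib_right)
  then show thesis using int_mult[of n] that unfolding G_def by auto
qed

text \<open>The sequence \<open>y\<close> that travels from \<open>U\<close> to \<open>V\<close> agrees with \<open>x\<close> up to index \<open>m\<close>, then spells a
  free word \<open>w\<close>, and then shows the window of \<open>x'\<close>, recentred at the arrival time \<open>n\<close>. The height
  must move from \<open>t\<close> to \<open>t'\<close>, which fixes the total weight, and \<open>w\<close> supplies what the two
  prescribed words leave open.\<close>

lemma skew_transitive:
  "transitive_system cylinder (skew :: (int \<Rightarrow> symbol) \<times> real \<Rightarrow> _)"
  unfolding transitive_system_def
proof (intro allI impI, elim conjE)
  fix U V :: "((int \<Rightarrow> symbol) \<times> real) set"
  assume U: "openin cylinder U" "U \<noteq> {}" and V: "openin cylinder V" "V \<noteq> {}"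
  obtain e t m x where U: "0 < e" "0 < t" "t < 1" "box m e (x, t) \<inter> topspace cylinder \<subseteq> U"
    using open_in_cylinder_contains_interior_box[OF U] .
  obtain e' t' m' x' where V: "0 < e'" "0 < t'" "t' < 1"
    "box m' e' (x', t') \<inter> topspace cylinder \<subseteq> V"
    using open_in_cylinder_contains_interior_box[OF V] .
  \<comment> \<open>Solving \<open>t powr exp c = t'\<close> for \<open>c\<close>; both logarithms are negative.\<close>
  define c where "c = ln (ln t' / ln t)"
  have "0 < ln t' / ln t" using U V by (simp add: divide_neg_neg)
  then have c: "t powr exp c = t'"
    using U V by (simp add: c_def powr_def)
  have "isCont (\<lambda>c. t powr exp c) c"
    using U by (intro continuous_intros) auto
  then obtain d where d: "d > 0" "\<And>b. \<bar>b - c\<bar> < d \<Longrightarrow> \<bar>t powr exp b - t'\<bar> < e'"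
    using V(1) c unfolding continuous_at_eps_delta dist_real_def by metis
  \<comment> \<open>The weight collected at the indices \<open>0..m\<close> before \<open>w\<close> and at the \<open>m'\<close> indices just before \<open>n\<close>.\<close>
  define r where "r = (\<Sum>k<Suc m. weight (x (int k))) + (\<Sum>k<m'. weight (x' (int k - int m')))"
  obtain w where w: "\<bar>sum_list (map weight w) - (c - r)\<bar> < d"
    using weights_dense[OF d(1)] .
  define l where "l = length w"
  define n where "n = Suc m + l + m'"
  define y where "y i = (if i \<le> int m then x i
      else if i < int (Suc m + l) then w ! nat (i - int (Suc m)) else x' (i - int n))" for i
  have "(\<Sum>k<n. weight (y (int k))) = (\<Sum>k<Suc m. weight (y (int k)))
      + (\<Sum>k<l. weight (y (int (Suc m + k)))) + (\<Sum>k<m'. weight (y (int (Suc m + l + k))))"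
    unfolding n_def sum_lessThan_split ..
  also have "(\<Sum>k<Suc m. weight (y (int k))) = (\<Sum>k<Suc m. weight (x (int k)))"
    by (rule sum.cong) (auto simp: y_def)
  also have "(\<Sum>k<l. weight (y (int (Suc m + k)))) = (\<Sum>k<l. weight (w ! k))"
    by (rule sum.cong) (auto simp: y_def)
  also have "\<dots> = sum_list (map weight w)"
    by (simp add: l_def sum_list_sum_nth lessThan_atLeast0)
  also have "(\<Sum>k<m'. weight (y (int (Suc m + l + k)))) = (\<Sum>k<m'. weight (x' (int k - int m')))"
    by (rule sum.cong) (auto simp: y_def n_def)
  finally have "(\<Sum>k<n. weight (y (int k))) = r + sum_list (map weight w)"
    by (simp add: r_def)
  then have near: "\<bar>t powr exp (\<Sum>k<n. weight (y (int k))) - t'\<bar> < e'"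
    using d(2) w by (simp add: algebra_simps)
  have "(y, t) \<in> U"
    by (rule subsetD[OF U(4)]) (use U in \<open>auto simp: box_def y_def\<close>)
  moreover have "(skew ^^ n) (y, t) \<in> V"
    unfolding skew_iterate[OF less_imp_le[OF U(2)]]
    by (rule subsetD[OF V(4)]) (use near U in \<open>auto simp: box_def y_def n_def powr_le1\<close>)
  ultimately show "\<exists>n. (skew ^^ n) ` U \<inter> V \<noteq> {}" by blast
qed

section \<open>Factors of the skew product\<close>

text \<open>Iterates of \<open>f\<close> at \<open>q p\<close> are images of iterates of \<open>F\<close> at \<open>p\<close>. Hence preimages of open sets
  transfer transitivity, and the images of the periodic points are periodic and dense.\<close>

lemma devaney_chaotic_factor:
  assumes q: "continuous_map X Y q" "q ` topspace X = topspace Y"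
    and Y: "compact_space Y" "metrizable_space Y"
    and F: "\<And>p. p \<in> topspace X \<Longrightarrow> F p \<in> topspace X"
      "transitive_system X F" "X closure_of periodic_points X F = topspace X"
    and f: "continuous_map Y Y f" "\<And>p. p \<in> topspace X \<Longrightarrow> f (q p) = q (F p)"
  shows "devaney_chaotic Y f"
proof -
  have iter: "(f ^^ n) (q p) = q ((F ^^ n) p) \<and> (F ^^ n) p \<in> topspace X"
    if "p \<in> topspace X" for n p
    using that by (induction n) (auto simp: F f)
  have "transitive_system Y f"
    unfolding transitive_system_def
  proof (intro allI impI, elim conjE)
    fix U V assume UV: "openin Y U" "U \<noteq> {}" "openin Y V" "V \<noteq> {}"
    have *: "openin X {p \<in> topspace X. q p \<in> W}" "{p \<in> topspace X. q p \<in> W} \<noteq> {}"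
      if "openin Y W" "W \<noteq> {}" for W
    proof -
      show "openin X {p \<in> topspace X. q p \<in> W}"
        using q(1) that(1) by (rule openin_continuous_map_preimage)
      have "W \<subseteq> q ` topspace X"
        using openin_subset[OF that(1)] q(2) by simp
      then show "{p \<in> topspace X. q p \<in> W} \<noteq> {}"
        using that(2) by blast
    qed
    have "\<exists>n. (F ^^ n) ` {p \<in> topspace X. q p \<in> U} \<inter> {p \<in> topspace X. q p \<in> V} \<noteq> {}"
      using F(2) *[OF UV(1,2)] *[OF UV(3,4)] unfolding transitive_system_def by simp
    then obtain n p where "p \<in> topspace X" "q p \<in> U" "q ((F ^^ n) p) \<in> V"
      by blast
    then have "(f ^^ n) (q p) \<in> V" and "(f ^^ n) (q p) \<in> (f ^^ n) ` U"
      using iter by (simp, blast)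
    then show "\<exists>n. (f ^^ n) ` U \<inter> V \<noteq> {}" by blast
  qed
  moreover have "q ` periodic_points X F \<subseteq> periodic_points Y f"
    using iter q by (fastforce simp: periodic_points_def)
  then have "topspace Y \<subseteq> Y closure_of periodic_points Y f"
    using continuous_map_image_closure_subset[OF q(1), of "periodic_points X F"] q(2) F(3)
    by (metis closure_of_mono order_trans)
  then have "Y closure_of periodic_points Y f = topspace Y"
    by (intro subset_antisym closure_of_subset_topspace)
  ultimately show ?thesis
    using Y f(1) by (simp add: devaney_chaotic_def dynamical_system_def)
qed

section \<open>Symbolic coordinates on the Cantor fan\<close>

definition ternary_value :: "(nat \<Rightarrow> bool) \<Rightarrow> real" where
  "ternary_value x = (\<Sum>n. (if x n then 2 else 0) / 3 ^ Suc n)"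

lemma ternary_summable: "summable (\<lambda>n. (if x n then 2 else 0) / 3 ^ Suc n :: real)"
proof (rule summable_comparison_test)
  show "summable (\<lambda>n. 2 / 3 * (1 / 3) ^ n :: real)"
    by (intro summable_mult summable_geometric) simp
qed (auto simp: power_divide field_simps)

lemma ternary_value_bounds: "0 \<le> ternary_value x" "ternary_value x \<le> 1"
proof -
  show "0 \<le> ternary_value x"
    unfolding ternary_value_def by (rule suminf_nonneg[OF ternary_summable]) auto
  have *: "(\<lambda>n. 2 / 3 * (1 / 3) ^ n) sums (2 / 3 * (1 / (1 - 1 / 3)) :: real)"
    by (intro sums_mult geometric_sums) simp
  have "ternary_value x \<le> (\<Sum>n. 2 / 3 * (1 / 3) ^ n)"
    unfolding ternary_value_def
    by (rule suminf_le[OF _ ternary_summable sums_summable[OF *]]) (simp add: power_divide)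
  also have "\<dots> = 1" using sums_unique[OF *] by simp
  finally show "ternary_value x \<le> 1" .
qed

text \<open>Self-similarity of the Cantor set. As values lie in \<open>[0,1]\<close>, the first digit decides between
  the disjoint intervals \<open>[0, 1/3]\<close> and \<open>[2/3, 1]\<close>; this makes injectivity an induction on the digit
  index.\<close>

lemma ternary_value_Suc:
  "ternary_value x = ((if x 0 then 2 else 0) + ternary_value (\<lambda>n. x (Suc n))) / 3"
proof -
  have "ternary_value x = (if x 0 then 2 else 0) / 3 ^ Suc 0
      + (\<Sum>n. (if x (Suc n) then 2 else 0) / 3 ^ Suc (Suc n))"
    unfolding ternary_value_def using suminf_split_head[OF ternary_summable[of x]] by simp
  also have "(\<Sum>n. (if x (Suc n) then 2 else 0) / 3 ^ Suc (Suc n)) = ternary_value (\<lambda>n. x (Suc n)) / 3"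
    unfolding ternary_value_def suminf_divide[OF ternary_summable, symmetric] by (simp add: mult_ac)
  finally show ?thesis by (simp add: add_divide_distrib)
qed

lemma inj_ternary_value: "inj ternary_value"
proof (rule injI)
  fix x y :: "nat \<Rightarrow> bool" assume "ternary_value x = ternary_value y"
  then have "x n = y n" for n
  proof (induction n arbitrary: x y)
    case 0
    then show ?case
      using ternary_value_Suc[of x] ternary_value_Suc[of y]
        ternary_value_bounds[of "\<lambda>n. x (Suc n)"] ternary_value_bounds[of "\<lambda>n. y (Suc n)"]
      by (auto split: if_splits)
  next
    case (Suc n)
    then have "ternary_value (\<lambda>n. x (Suc n)) = ternary_value (\<lambda>n. y (Suc n))"
      using ternary_value_Suc[of x] ternary_value_Suc[of y]
        ternary_value_bounds[of "\<lambda>n. x (Suc n)"] ternary_value_bounds[of "\<lambda>n. y (Suc n)"]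
      by (auto split: if_splits)
    then show ?case using Suc.IH by blast
  qed
  then show "x = y" ..
qed

lemma continuous_on_ternary_value: "continuous_on UNIV ternary_value"
proof -
  have coord: "continuous_on UNIV (\<lambda>x. if x n then 2 else 0 :: real)" for n
    by (rule continuous_on_compose2[of UNIV "\<lambda>b. if b then 2 else 0" UNIV "\<lambda>x. x n"]) auto
  have "uniform_limit UNIV (\<lambda>N x. \<Sum>n<N. (if x n then 2 else 0) / 3 ^ Suc n) ternary_value sequentially"
    unfolding ternary_value_def
  proof (rule Weierstrass_m_test)
    show "summable (\<lambda>n. 2 / 3 * (1 / 3) ^ n :: real)"
      by (intro summable_mult summable_geometric) simp
  qed (auto simp: power_divide field_simps)
  then show ?thesis
    by (rule uniform_limit_theorem[rotated])
      (auto intro!: always_eventually continuous_intros coord)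
qed

lemma range_ternary_value: "range ternary_value = ternary_cantor_set"
proof (intro equalityI subsetI)
  fix c assume "c \<in> ternary_cantor_set"
  then obtain a where a: "c = (\<Sum>n. a n / 3 ^ Suc n)" "\<And>n. a n \<in> {0, 2}"
    unfolding ternary_cantor_set_def by blast
  have "a = (\<lambda>n. if a n = 2 then 2 else 0)" using a(2) by force
  then have "c = ternary_value (\<lambda>n. a n = 2)"
    unfolding ternary_value_def a(1) by metis
  then show "c \<in> range ternary_value" by blast
next
  fix c assume "c \<in> range ternary_value"
  then obtain x where "c = ternary_value x" by blast
  then show "c \<in> ternary_cantor_set"
    unfolding ternary_cantor_set_def ternary_value_def
    by (intro CollectI exI[of _ "\<lambda>n. if x n then 2 else 0"]) auto
qed

text \<open>A sequence of symbols indexed by \<open>'i\<close> is a family of bits indexed by \<open>'i \<times> bool\<close>. This index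
  set is countably infinite, so renumbering it makes the sequence space a copy of \<open>nat \<Rightarrow> bool\<close>,
  which the ternary expansion identifies with the Cantor set.\<close>

lemma cantor_set_coordinates:
  assumes "cantor_set K" "infinite (UNIV :: 'i::countable set)"
  obtains \<kappa> :: "('i::countable \<Rightarrow> symbol) \<Rightarrow> real"
  where "continuous_on UNIV \<kappa>" "inj \<kappa>" "range \<kappa> = K"
proof -
  have "infinite (UNIV :: ('i \<times> bool) set)"
    using assms(2) by (simp add: finite_prod)
  then obtain e :: "'i \<times> bool \<Rightarrow> nat" where e: "bij e"
    using to_nat_on_infinite[of "UNIV :: ('i \<times> bool) set"] by blast
  define bits where "bits x n = (let (i, b) = inv e n in if b then fst (x i) else snd (x i))"
    for x :: "'i \<Rightarrow> symbol" and n
  have bits_e: "bits x (e (i, b)) = (if b then fst (x i) else snd (x i))" for x i b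
    using e by (simp add: bits_def bij_is_inj)
  have cont: "continuous_on UNIV bits"
  proof (rule continuous_on_coordinatewise_then_product)
    fix n
    obtain i b where "inv e n = (i, b)" by fastforce
    then have eq: "bits x n = (if b then fst (x i) else snd (x i))" for x
      by (simp add: bits_def)
    show "continuous_on UNIV (\<lambda>x. bits x n)"
      unfolding eq by (cases b) (auto intro!: continuous_on_fst continuous_on_snd)
  qed
  have inj: "inj bits"
  proof (intro injI ext)
    fix x y :: "'i \<Rightarrow> symbol" and i assume "bits x = bits y"
    then show "x i = y i"
      using bits_e[of _ i True] bits_e[of _ i False] by (metis prod_eqI)
  qed
  have surj: "surj bits"
  proof (rule surjI, rule ext)
    fix z n
    obtain i b where "n = e (i, b)" using e by (metis bij_pointE surj_pair)
    then show "bits (\<lambda>i. (z (e (i, True)), z (e (i, False)))) n = z n"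
      by (simp add: bits_e)
  qed
  obtain g g' where g: "homeomorphism ternary_cantor_set K g g'"
    using assms(1) unfolding cantor_set_def by (metis homeomorphic_def homeomorphic_sym)
  show thesis
  proof (rule that[of "\<lambda>x. g (ternary_value (bits x))"])
    show "continuous_on UNIV (\<lambda>x. g (ternary_value (bits x)))"
      by (rule continuous_on_compose2[OF homeomorphism_cont1[OF g]])
        (auto simp flip: range_ternary_value
          intro: continuous_on_compose2[OF continuous_on_ternary_value cont])
    show "inj (\<lambda>x. g (ternary_value (bits x)))"
    proof (rule injI)
      fix x y assume "g (ternary_value (bits x)) = g (ternary_value (bits y))"
      then have "ternary_value (bits x) = ternary_value (bits y)"
        using homeomorphism_apply1[OF g] range_ternary_value by (metis rangeI)
      then show "x = y" using inj inj_ternary_value by (simp add: inj_eq)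
    qed
    have "range (\<lambda>x. g (ternary_value (bits x))) = g ` ternary_value ` range bits" by auto
    also have "\<dots> = K" using surj homeomorphism_image1[OF g] range_ternary_value by simp
    finally show "range (\<lambda>x. g (ternary_value (bits x))) = K" .
  qed
qed

lemma compact_cylinder: "compact_space (cylinder :: (('i \<Rightarrow> symbol) \<times> real) topology)"
proof -
  have "compact (UNIV :: symbol set)" by (simp add: finite_imp_compact)
  then have "compact_space (product_topology (\<lambda>i::'i. euclidean :: symbol topology) UNIV)"
    by (simp add: compact_space_product_topology) (simp add: compact_space_def)
  then have "compact (UNIV :: ('i \<Rightarrow> symbol) set)"
    by (simp add: euclidean_product_topology compact_space_def)
  then show ?thesis
    by (simp add: compact_space_subtopology compact_Times)
qed

definition cone_projection :: "(('i \<Rightarrow> symbol) \<times> real \<Rightarrow> 'a) \<Rightarrow> 'a topology \<Rightarrow> bool" where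
  "cone_projection q C \<longleftrightarrow> quotient_map cylinder C q \<and>
     (\<forall>p\<in>topspace cylinder. \<forall>p'\<in>topspace cylinder.
        q p = q p' \<longleftrightarrow> snd p = snd p' \<and> (snd p = 0 \<or> fst p = fst p'))"

lemma cone_projectionD:
  assumes "cone_projection q C"
  shows "quotient_map cylinder C q"
    "\<And>p p'. p \<in> topspace cylinder \<Longrightarrow> p' \<in> topspace cylinder \<Longrightarrow>
      q p = q p' \<longleftrightarrow> snd p = snd p' \<and> (snd p = 0 \<or> fst p = fst p')"
  using assms unfolding cone_projection_def by blast+

lemma cantor_fan_coordinates:
  assumes "cantor_fan C" "infinite (UNIV :: 'i::countable set)"
  obtains q :: "('i::countable \<Rightarrow> symbol) \<times> real \<Rightarrow> 'a"
  where "cone_projection q C"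
proof -
  obtain K where C: "continuum C" and K: "cantor_set K"
    "C homeomorphic_space top_of_set (planar_fan K)"
    using assms(1) unfolding cantor_fan_def by blast
  obtain g where g: "homeomorphic_map (top_of_set (planar_fan K)) C g"
    using K(2) homeomorphic_space homeomorphic_space_sym by blast
  obtain \<kappa> :: "('i \<Rightarrow> symbol) \<Rightarrow> real"
    where \<kappa>: "continuous_on UNIV \<kappa>" "inj \<kappa>" "range \<kappa> = K"
    using cantor_set_coordinates[OF K(1) assms(2)] .
  define r :: "('i \<Rightarrow> symbol) \<times> real \<Rightarrow> real \<times> real"
    where "r p = (snd p * \<kappa> (fst p), - snd p)" for p
  have image: "r ` (UNIV \<times> {0..1}) = planar_fan K"
  proof -
    have "closed_segment (0, 0) (c, - 1) = (\<lambda>t. (t * c, - t)) ` {0..1}" for c :: real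
      by (auto simp: closed_segment_def)
    then have "planar_fan K = (\<Union>x. (\<lambda>t. r (x, t)) ` {0..1})"
      by (simp add: planar_fan_def r_def flip: \<kappa>(3))
    then show ?thesis by auto
  qed
  have "continuous_on A (\<lambda>p. \<kappa> (fst p))" for A :: "(('i \<Rightarrow> symbol) \<times> real) set"
    by (rule continuous_on_compose2[OF \<kappa>(1)]) (auto intro: continuous_intros)
  then have "continuous_on (UNIV \<times> {0..1}) r"
    unfolding r_def by (intro continuous_intros)
  then have "continuous_map cylinder (top_of_set (planar_fan K)) r"
    using image by auto
  then have cont: "continuous_map cylinder C (g \<circ> r)"
    using g homeomorphic_imp_continuous_map continuous_map_compose by blast
  have surj: "(g \<circ> r) ` topspace cylinder = topspace C"
    using homeomorphic_imp_surjective_map[OF g] image by (simp add: image_comp[symmetric] del: o_apply)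
  have "quotient_map cylinder C (g \<circ> r)"
    using C cont surj compact_cylinder unfolding continuum_def
    by (intro continuous_imp_quotient_map metrizable_imp_Hausdorff_space) auto
  moreover have "(g \<circ> r) p = (g \<circ> r) p' \<longleftrightarrow> snd p = snd p' \<and> (snd p = 0 \<or> fst p = fst p')"
    if "p \<in> topspace cylinder" "p' \<in> topspace cylinder" for p p'
  proof -
    have "r p \<in> planar_fan K" "r p' \<in> planar_fan K"
      using that image by auto
    then have "(g \<circ> r) p = (g \<circ> r) p' \<longleftrightarrow> r p = r p'"
      using homeomorphic_imp_injective_map[OF g] by (auto simp: inj_on_def)
    also have "\<dots> \<longleftrightarrow> snd p = snd p' \<and> (snd p = 0 \<or> fst p = fst p')"
      using \<kappa>(2) by (auto simp: r_def inj_eq)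
    finally show ?thesis .
  qed
  ultimately show thesis
    by (intro that[of "g \<circ> r"]) (auto simp: cone_projection_def simp del: o_apply)
qed

text \<open>The fibre maps fix \<open>0\<close>, so the skew product respects the collapsing of the slice \<open>t = 0\<close>.\<close>

lemma skew_induces_fan_map:
  fixes q :: "('i::comm_semiring_1 \<Rightarrow> symbol) \<times> real \<Rightarrow> 'a"
  assumes "cone_projection q C"
  obtains f where "continuous_map C C f" "\<forall>p\<in>topspace cylinder. f (q p) = q (skew p)"
proof -
  note q = cone_projectionD(1)[OF assms] and fibres = cone_projectionD(2)[OF assms]
  have cont: "continuous_map cylinder C (q \<circ> skew)"
    using continuous_map_skew quotient_imp_continuous_map[OF q] continuous_map_compose by blast
  have resp: "(q \<circ> skew) p = (q \<circ> skew) p'"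
    if "p \<in> topspace cylinder" "p' \<in> topspace cylinder" "q p = q p'" for p p'
  proof -
    have "snd p = snd p'" "snd p = 0 \<or> fst p = fst p'"
      using fibres that by blast+
    then show ?thesis
      using fibres[OF skew_in_cylinder[OF that(1)] skew_in_cylinder[OF that(2)]]
      by (auto simp: skew_def)
  qed
  show thesis
  proof (rule quotient_map_lift_exists[OF q cont resp])
    fix f assume f: "continuous_map C C f"
      "\<And>p. p \<in> topspace cylinder \<Longrightarrow> f (q p) = (q \<circ> skew) p"
    show thesis by (rule that[OF f(1)]) (use f(2) in \<open>unfold o_apply, blast\<close>)
  qed
qed

section \<open>The two maps\<close>

text \<open>Bijectivity is enough for a homeomorphism, since the fan is compact and Hausdorff. It is
  inherited from the two-sided skew product, which moreover sends no positive height to \<open>0\<close>.\<close>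

lemma chaotic_homeomorphism_exists:
  assumes "cantor_fan C"
  shows "\<exists>h. homeomorphic_map C C h \<and> devaney_chaotic C h"
proof -
  have C: "compact_space C" "metrizable_space C"
    using assms by (auto simp: cantor_fan_def continuum_def)
  obtain q :: "(int \<Rightarrow> symbol) \<times> real \<Rightarrow> 'a" where cone: "cone_projection q C"
    using cantor_fan_coordinates[OF assms infinite_UNIV_int] .
  note q = cone_projectionD(1)[OF cone] and fibres = cone_projectionD(2)[OF cone]
  obtain h where h: "continuous_map C C h"
    and semiconj: "\<forall>p\<in>topspace cylinder. h (q p) = q (skew p)"
    using skew_induces_fan_map[OF cone] .
  note surj = quotient_imp_surjective_map[OF q]
  have "h ` topspace C = q ` skew ` topspace cylinder"
    unfolding surj[symmetric] image_image using semiconj by (intro image_cong) auto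
  then have "h ` topspace C = topspace C"
    using skew_surj surj by simp
  moreover have "inj_on h (topspace C)"
    unfolding surj[symmetric]
  proof (rule inj_onI, elim imageE, hypsubst)
    fix p p' :: "(int \<Rightarrow> symbol) \<times> real"
    assume p: "p \<in> topspace cylinder" "p' \<in> topspace cylinder" and "h (q p) = h (q p')"
    then have eq: "snd (skew p) = snd (skew p')"
        "snd (skew p) = 0 \<or> fst (skew p) = fst (skew p')"
      using semiconj fibres[OF skew_in_cylinder skew_in_cylinder] by force+
    from eq(2) show "q p = q p'"
    proof
      assume "snd (skew p) = 0"
      then have "snd p = 0" "snd p' = 0" using eq(1) by (auto simp: skew_def)
      then show ?thesis using fibres p by simp
    next
      assume "fst (skew p) = fst (skew p')"
      then have "skew p = skew p'" using eq(1) by (rule prod_eqI)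
      then show ?thesis using skew_inj p by (auto dest: inj_onD)
    qed
  qed
  ultimately have "homeomorphic_map C C h"
    using C h by (intro continuous_imp_homeomorphic_map metrizable_imp_Hausdorff_space)
  moreover have "devaney_chaotic C h"
    by (rule devaney_chaotic_factor[OF quotient_imp_continuous_map[OF q] surj C
        skew_in_cylinder skew_transitive skew_periodic_dense h bspec[OF semiconj]])
  ultimately show ?thesis by blast
qed

text \<open>The chaotic system upstairs is still the two-sided skew product; \<open>\<rho>\<close> restricts a sequence to
  its nonnegative indices before projecting to the fan.\<close>

lemma chaotic_noninjective_map_exists:
  assumes "cantor_fan C"
  shows "\<exists>f. continuous_map C C f \<and> \<not> homeomorphic_map C C f \<and> devaney_chaotic C f"
proof -
  have C: "compact_space C" "metrizable_space C"
    using assms by (auto simp: cantor_fan_def continuum_def)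
  obtain q :: "(nat \<Rightarrow> symbol) \<times> real \<Rightarrow> 'a" where cone: "cone_projection q C"
    using cantor_fan_coordinates[OF assms infinite_UNIV_nat] .
  note q = cone_projectionD(1)[OF cone] and fibres = cone_projectionD(2)[OF cone]
  obtain f where f: "continuous_map C C f"
    and semiconj: "\<forall>p\<in>topspace cylinder. f (q p) = q (skew p)"
    using skew_induces_fan_map[OF cone] .
  note surj = quotient_imp_surjective_map[OF q]
  have "\<not> inj_on f (topspace C)"
  proof
    assume inj: "inj_on f (topspace C)"
    define x y :: "nat \<Rightarrow> symbol"
      where "x = (\<lambda>n. (True, True))" and "y = (\<lambda>n. (True, n \<noteq> 0))"
    \<comment> \<open>The two sequences differ at index \<open>0\<close> only, and the height \<open>1\<close> is fixed by every fibre map.\<close>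
    have xy: "(x, 1) \<in> topspace cylinder" "(y, 1) \<in> topspace cylinder" by auto
    have "skew (x, 1) = skew (y, 1)" by (simp add: skew_def x_def y_def)
    then have "f (q (x, 1)) = f (q (y, 1))" using semiconj xy by metis
    then have "q (x, 1) = q (y, 1)"
      using inj surj xy by (auto dest!: inj_onD)
    then have "x 0 = y 0" using fibres[OF xy] by simp
    then show False by (simp add: x_def y_def)
  qed
  then have "\<not> homeomorphic_map C C f"
    using homeomorphic_imp_injective_map by blast
  define \<rho> :: "(int \<Rightarrow> symbol) \<times> real \<Rightarrow> (nat \<Rightarrow> symbol) \<times> real"
    where "\<rho> p = (\<lambda>n. fst p (int n), snd p)" for p
  have "continuous_on A (\<lambda>p. fst p i)" for A :: "((int \<Rightarrow> symbol) \<times> real) set" and i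
    by (rule continuous_on_product_then_coordinatewise) (intro continuous_intros)
  then have "continuous_on (UNIV \<times> {0..1}) \<rho>"
    unfolding \<rho>_def
    by (intro continuous_on_Pair continuous_on_coordinatewise_then_product continuous_intros)
  then have cont: "continuous_map cylinder cylinder \<rho>"
    by (auto simp: \<rho>_def)
  have image: "\<rho> ` topspace cylinder = topspace cylinder"
  proof (intro equalityI subsetI)
    fix p assume "p \<in> topspace (cylinder :: ((nat \<Rightarrow> symbol) \<times> real) topology)"
    then show "p \<in> \<rho> ` topspace cylinder"
      by (intro image_eqI[of _ _ "(\<lambda>i. fst p (nat i), snd p)"]) (auto simp: \<rho>_def)
  qed (auto simp: \<rho>_def)
  have "devaney_chaotic C f"
  proof (rule devaney_chaotic_factor[OF _ _ C skew_in_cylinder skew_transitive skew_periodic_dense f])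
    show "continuous_map cylinder C (q \<circ> \<rho>)"
      using continuous_map_compose[OF cont quotient_imp_continuous_map[OF q]] .
    show "(q \<circ> \<rho>) ` topspace cylinder = topspace C"
      unfolding image_comp[symmetric] image surj ..
    fix p :: "(int \<Rightarrow> symbol) \<times> real" assume "p \<in> topspace cylinder"
    then have "\<rho> p \<in> topspace cylinder" by (auto simp: \<rho>_def)
    moreover have "skew (\<rho> p) = \<rho> (skew p)"
      by (simp add: skew_def \<rho>_def add.commute)
    ultimately show "f ((q \<circ> \<rho>) p) = (q \<circ> \<rho>) (skew p)"
      using bspec[OF semiconj, of "\<rho> p"] by simp
  qed
  with f \<open>\<not> homeomorphic_map C C f\<close> show ?thesis by blast
qed

theorem theorem4p11:
  fixes C :: "'a topology"
  assumes "cantor_fan C"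
  shows "(\<exists>f. continuous_map C C f \<and> \<not> homeomorphic_map C C f \<and> devaney_chaotic C f) \<and>
         (\<exists>h. homeomorphic_map C C h \<and> devaney_chaotic C h)"
  using chaotic_noninjective_map_exists[OF assms] chaotic_homeomorphism_exists[OF assms] by blast

end
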